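(* Let $n\ge 1$ and let $\mathbf{H}$ be an $n\times n$ Hadamard matrix. For $1\le i\le n$ let $\delta_i,\gamma_i$ be integers and $\Delta_i,\Gamma_i$ be positive integers, and define $$DQ_i(x)=\operatorname{sign}(x)\left\lfloor \frac{\max(0,|x|+\delta_i)}{\Delta_i}\right\rfloor,\qquad IQ_i(x)=\operatorname{sign}(x)\,(\Gamma_i|x|+\gamma_i),$$ and for a vector $\mathbf{v}=(v_1,\dots,v_n)$ set $\mathbf{DQ}(\mathbf{v})=(DQ_1(v_1),\dots,DQ_n(v_n))$ and $\mathbf{IQ}(\mathbf{v})=(IQ_1(v_1),\dots,IQ_n(v_n))$. For $\mathbf{x}\in\mathbb{Z}^n$ let $$\mathbf{x}'=\mathbf{H}^T\,\mathbf{IQ}\!\left(\mathbf{DQ}\!\left(\tfrac1n\mathbf{H}\mathbf{x}\right)\right).$$ Then for every $\mathbf{x}\in\mathbb{Z}^n$, $$\|\mathbf{x}'-\mathbf{x}\|_\infty\le n\max_{1\le i\le n}\max S_i,$$ where, writing $X=\|\mathbf{x}\|_\infty$, the finite set $S_i$ of nonnegative reals consists of: - $|\Delta_i-\delta_i|$ (always); - if $X\ge \Delta_i-\delta_i$: the numbers $|(\Gamma_i-\Delta_i)+\gamma_i+\delta_i|$ and $\left|\left\lfloor \frac{X+\delta_i}{\Delta_i}\right\rfloor(\Gamma_i-\Delta_i)+\gamma_i+\delta_i\right|$; - if $X>\Delta_i-\delta_i$: the numbers $|2(\Gamma_i-\Delta_i)+\gamma_i+\delta_i-\Gamma_i|$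 and $\left|\left\lceil \frac{X+\delta_i}{\Delta_i}\right\rceil(\Gamma_i-\Delta_i)+\gamma_i+\delta_i-\Gamma_i\right|$. Moreover, if $\Delta_i=\Gamma_i$ for all $i$, then for every $\mathbf{x}\in\mathbb{Z}^n$, $$\|\mathbf{x}'-\mathbf{x}\|_\infty\le n\max_{1\le i\le n}\max\bigl(|\gamma_i+\delta_i|,\ |\gamma_i+\delta_i-\Delta_i|,\ |\Delta_i-\delta_i|\bigr).$$
   Context: A Hadamard matrix of order $n$ is an $n\times n$ matrix with entries in $\{+1,-1\}$ whose rows are mutually orthogonal (so $\mathbf{H}^T\mathbf{H}=n\mathbf{I}_n$). $\operatorname{sign}(x)$ is $1$, $0$, $-1$ for $x>0$, $x=0$, $x<0$ respectively. $\|\mathbf{v}\|_\infty=\max_i|v_i|$. *)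

theory Defs
  imports "HOL-Analysis.Analysis"
begin

definition hadamard :: "real^'n^'n \<Rightarrow> bool" where
  "hadamard H \<longleftrightarrow>
     (\<forall>i j. H $ i $ j \<in> {1, -1}) \<and>
     (\<forall>i j. i \<noteq> j \<longrightarrow> row i H \<bullet> row j H = 0)"

definition DQ :: "int \<Rightarrow> int \<Rightarrow> real \<Rightarrow> real" where
  "DQ \<delta> \<Delta> x = sgn x * of_int \<lfloor>max 0 (\<bar>x\<bar> + of_int \<delta>) / of_int \<Delta>\<rfloor>"

definition IQ :: "int \<Rightarrow> int \<Rightarrow> real \<Rightarrow> real" where
  "IQ \<gamma> \<Gamma> x = sgn x * (of_int \<Gamma> * \<bar>x\<bar> + of_int \<gamma>)"

definition DQ_vec :: "('n \<Rightarrow> int) \<Rightarrow> ('n \<Rightarrow> int) \<Rightarrow> real^'n \<Rightarrow> real^'n" where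
  "DQ_vec \<delta> \<Delta> v = (\<chi> i. DQ (\<delta> i) (\<Delta> i) (v $ i))"

definition IQ_vec :: "('n \<Rightarrow> int) \<Rightarrow> ('n \<Rightarrow> int) \<Rightarrow> real^'n \<Rightarrow> real^'n" where
  "IQ_vec \<gamma> \<Gamma> v = (\<chi> i. IQ (\<gamma> i) (\<Gamma> i) (v $ i))"

definition real_vec :: "int^'n \<Rightarrow> real^'n" where
  "real_vec x = (\<chi> i. of_int (x $ i))"

definition reconstruct ::
  "real^'n^'n \<Rightarrow> ('n \<Rightarrow> int) \<Rightarrow> ('n \<Rightarrow> int) \<Rightarrow> ('n \<Rightarrow> int) \<Rightarrow> ('n \<Rightarrow> int) \<Rightarrow> int^'n \<Rightarrow> real^'n" where
  "reconstruct H \<delta> \<gamma> \<Delta> \<Gamma> x =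
     transpose H *v
       IQ_vec \<gamma> \<Gamma> (DQ_vec \<delta> \<Delta> ((1 / real CARD('n)) *\<^sub>R (H *v real_vec x)))"

definition err_set :: "int \<Rightarrow> int \<Rightarrow> int \<Rightarrow> int \<Rightarrow> real \<Rightarrow> real set" where
  "err_set \<delta> \<gamma> \<Delta> \<Gamma> X =
     {of_int \<bar>\<Delta> - \<delta>\<bar>} \<union>
     (if X \<ge> of_int (\<Delta> - \<delta>) then
        {of_int \<bar>(\<Gamma> - \<Delta>) + \<gamma> + \<delta>\<bar>,
         of_int \<bar>\<lfloor>(X + of_int \<delta>) / of_int \<Delta>\<rfloor> * (\<Gamma> - \<Delta>) + \<gamma> + \<delta>\<bar>}
      else {}) \<union>
     (if X > of_int (\<Delta> - \<delta>) then
        {of_int \<bar>2 * (\<Gamma> - \<Delta>) + \<gamma> + \<delta> - \<Gamma>\<bar>,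
         of_int \<bar>\<lceil>(X + of_int \<delta>) / of_int \<Delta>\<rceil> * (\<Gamma> - \<Delta>) + \<gamma> + \<delta> - \<Gamma>\<bar>}
      else {})"

end

theory Submission
  imports Defs
begin

text \<open>Since \<open>H\<^sup>T H = n I\<close>, the reconstruction error is \<open>H\<^sup>T\<close> applied to the vector of
  scalar quantization errors of \<open>y = H x / n\<close>, and \<open>\<bar>y\<^sub>j\<bar> \<le> \<parallel>x\<parallel>\<^sub>\<infinity>\<close>; both facts use that the
  entries of \<open>H\<close> are \<open>\<plusminus>1\<close>.  For a scalar \<open>y\<close> quantized to level \<open>q \<ge> 1\<close>, write
  \<open>\<bar>y\<bar> + \<delta> = q \<Delta> + r\<close> with \<open>0 \<le> r < \<Delta>\<close>: the error lies between the values at \<open>r = 0\<close> and \<open>r = \<Delta>\<close>,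
  which are affine in \<open>q\<close> and hence bounded by their values at the extreme levels.\<close>

lemma affine_le_max_endpoints:
  fixes a b c d q :: "'a::linordered_idom"
  assumes "a \<le> q" "q \<le> b"
  shows "q * c + d \<le> max (a * c + d) (b * c + d)"
proof (cases "c \<ge> 0")
  case True
  then show ?thesis using assms by (simp add: mult_right_mono le_max_iff_disj)
next
  case False
  then show ?thesis using assms by (simp add: mult_right_mono_neg le_max_iff_disj)
qed

lemma affine_ge_min_endpoints:
  fixes a b c d q :: "'a::linordered_idom"
  assumes "a \<le> q" "q \<le> b"
  shows "min (a * c + d) (b * c + d) \<le> q * c + d"
  using affine_le_max_endpoints[OF assms, of "- c" "- d"] by (simp add: max_def min_def split: if_splits)

text \<open>Since \<open>\<Delta>\<close> is positive, the floor is nonnegative exactly when its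
  numerator is, so the clamp can move outside. The cases \<open>q < 1\<close> and
  \<open>q \<ge> 1\<close> of the unclamped level \<open>q\<close> then decide everything.\<close>

lemma DQ_eq:
  assumes "\<Delta> > 0"
  shows "DQ \<delta> \<Delta> y = sgn y * of_int (max 0 \<lfloor>(\<bar>y\<bar> + of_int \<delta>) / of_int \<Delta>\<rfloor>)"
proof -
  have "\<lfloor>max 0 (\<bar>y\<bar> + of_int \<delta>) / of_int \<Delta>\<rfloor> = max 0 \<lfloor>(\<bar>y\<bar> + of_int \<delta>) / of_int \<Delta>\<rfloor>"
    using assms by (auto simp: max_def divide_neg_pos zero_le_divide_iff)
  then show ?thesis by (simp add: DQ_def)
qed

text \<open>At level 0 all of \<open>y\<close> is lost; at a positive level the sign survives and
  only magnitudes are compared. The condition \<open>y \<noteq> 0\<close> matters because a large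
  \<open>\<delta>\<close> gives \<open>q \<ge> 1\<close> even at \<open>y = 0\<close>, where
  \<open>DQ\<close> returns 0.\<close>

lemma quantization_error_level:
  fixes y :: real
  assumes "\<Delta> > 0" and q: "q = \<lfloor>(\<bar>y\<bar> + of_int \<delta>) / of_int \<Delta>\<rfloor>"
  shows "q < 1 \<Longrightarrow> \<bar>IQ \<gamma> \<Gamma> (DQ \<delta> \<Delta> y) - y\<bar> = \<bar>y\<bar>"
    and "q \<ge> 1 \<Longrightarrow> y \<noteq> 0 \<Longrightarrow>
      \<bar>IQ \<gamma> \<Gamma> (DQ \<delta> \<Delta> y) - y\<bar> = \<bar>of_int (\<Gamma> * q + \<gamma>) - \<bar>y\<bar>\<bar>"
proof -
  show "\<bar>IQ \<gamma> \<Gamma> (DQ \<delta> \<Delta> y) - y\<bar> = \<bar>y\<bar>" if "q < 1"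
    using that by (simp add: DQ_eq[OF assms(1)] IQ_def flip: q)
  assume q1: "q \<ge> 1" and "y \<noteq> 0"
  then have "IQ \<gamma> \<Gamma> (DQ \<delta> \<Delta> y) = sgn y * of_int (\<Gamma> * q + \<gamma>)"
    by (auto simp add: DQ_eq[OF assms(1)] IQ_def sgn_mult abs_mult abs_sgn_eq simp flip: q)
  then show "\<bar>IQ \<gamma> \<Gamma> (DQ \<delta> \<Delta> y) - y\<bar> = \<bar>of_int (\<Gamma> * q + \<gamma>) - \<bar>y\<bar>\<bar>"
    using \<open>y \<noteq> 0\<close> by (cases "y > 0") (auto simp: abs_real_def)
qed

text \<open>A witness in place of \<open>Max\<close> lets the bound pass through a set inclusion
  when the step sizes agree.\<close>

lemma quantization_error_le_err_set:
  fixes y X :: real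
  assumes \<Delta>: "\<Delta> > 0" and yX: "\<bar>y\<bar> \<le> X"
  shows "\<exists>s \<in> err_set \<delta> \<gamma> \<Delta> \<Gamma> X. \<bar>IQ \<gamma> \<Gamma> (DQ \<delta> \<Delta> y) - y\<bar> \<le> s"
proof (cases "y = 0")
  case True
  then show ?thesis by (intro bexI[of _ "of_int \<bar>\<Delta> - \<delta>\<bar>"]) (auto simp: err_set_def DQ_def IQ_def)
next
  case False
  define q where "q = \<lfloor>(\<bar>y\<bar> + of_int \<delta>) / of_int \<Delta>\<rfloor>"
  define t where "t = (X + of_int \<delta>) / of_int \<Delta>"
  have \<Delta>': "real_of_int \<Delta> > 0" using \<Delta> by simp
  have lo: "of_int q * of_int \<Delta> \<le> \<bar>y\<bar> + of_int \<delta>"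
    unfolding q_def using \<Delta>' by (simp add: floor_divide_lower)
  have hi: "\<bar>y\<bar> + of_int \<delta> < (of_int q + 1) * of_int \<Delta>"
    unfolding q_def using \<Delta>' by (simp add: floor_divide_upper)
  show ?thesis
  proof (cases "q < 1")
    case True
    have "(of_int q + 1) * real_of_int \<Delta> \<le> 1 * of_int \<Delta>"
      by (rule mult_right_mono) (use True \<Delta> in auto)
    with hi have "\<bar>y\<bar> \<le> of_int \<bar>\<Delta> - \<delta>\<bar>" by simp
    with quantization_error_level(1)[OF \<Delta> q_def True] show ?thesis
      by (intro bexI[of _ "of_int \<bar>\<Delta> - \<delta>\<bar>"]) (auto simp: err_set_def)
  next
    case False
    then have q1: "q \<ge> 1" by simp
    have err: "\<bar>IQ \<gamma> \<Gamma> (DQ \<delta> \<Delta> y) - y\<bar> = \<bar>of_int (\<Gamma> * q + \<gamma>) - \<bar>y\<bar>\<bar>"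
      by (rule quantization_error_level(2)[OF \<Delta> q_def q1 \<open>y \<noteq> 0\<close>])
    \<comment> \<open>A level of at least 1 forces
      \<open>\<bar>y\<bar> \<ge> \<Delta> - \<delta>\<close>, which brings the first conditional
      pair into \<open>err_set\<close>.\<close>
    have "1 * real_of_int \<Delta> \<le> of_int q * of_int \<Delta>"
      by (rule mult_right_mono) (use q1 \<Delta> in auto)
    with lo yX have X: "of_int (\<Delta> - \<delta>) \<le> X" by simp
    have qt: "q \<le> \<lfloor>t\<rfloor>"
      unfolding q_def t_def using yX \<Delta>' by (intro floor_mono divide_right_mono) auto
    let ?e = "of_int (\<Gamma> * q + \<gamma>) - \<bar>y\<bar>"
    \<comment> \<open>\<open>?A q\<close> is the signed error at remainder 0. \<open>?B\<close> is
      indexed by the upper end of the cell: \<open>?B (q + 1)\<close> is the limiting error at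
      remainder \<open>\<Delta>\<close>. This shift turns the extreme levels into 2 and
      \<open>\<lceil>t\<rceil>\<close>.\<close>
    let ?A = "\<lambda>m. m * (\<Gamma> - \<Delta>) + (\<gamma> + \<delta>)" and ?B = "\<lambda>m. m * (\<Gamma> - \<Delta>) + (\<gamma> + \<delta> - \<Gamma>)"
    have S: "of_int \<bar>?A 1\<bar> \<in> err_set \<delta> \<gamma> \<Delta> \<Gamma> X" "of_int \<bar>?A \<lfloor>t\<rfloor>\<bar> \<in> err_set \<delta> \<gamma> \<Delta> \<Gamma> X"
      using X by (simp_all add: err_set_def t_def algebra_simps)
    have S': "of_int \<bar>?B 2\<bar> \<in> err_set \<delta> \<gamma> \<Delta> \<Gamma> X" "of_int \<bar>?B \<lceil>t\<rceil>\<bar> \<in> err_set \<delta> \<gamma> \<Delta> \<Gamma> X"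
      if "X > of_int (\<Delta> - \<delta>)"
      using that by (simp_all add: err_set_def t_def algebra_simps)
    have e_le: "?e \<le> of_int (?A q)"
      using lo by (simp add: algebra_simps)
    have e_ge: "of_int (?B (q + 1)) \<le> ?e"
      using hi by (simp add: algebra_simps)
    show ?thesis
    proof (cases "?e \<ge> 0")
      case True
      have "?A q \<le> max (?A 1) (?A \<lfloor>t\<rfloor>)" by (rule affine_le_max_endpoints[OF q1 qt])
      then have "?A q \<le> \<bar>?A 1\<bar> \<or> ?A q \<le> \<bar>?A \<lfloor>t\<rfloor>\<bar>" by linarith
      then have "\<bar>?e\<bar> \<le> of_int \<bar>?A 1\<bar> \<or> \<bar>?e\<bar> \<le> of_int \<bar>?A \<lfloor>t\<rfloor>\<bar>"
        using e_le True by (metis abs_of_nonneg of_int_le_iff order_trans)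
      with S err show ?thesis by auto
    next
      case neg: False
      show ?thesis
      proof (cases "q + 1 \<le> \<lceil>t\<rceil>")
        case True
        \<comment> \<open>Here \<open>\<lceil>t\<rceil> \<ge> q + 1 \<ge> 2\<close>, and
          \<open>t > 1\<close> is the strict condition on \<open>X\<close> that admits the second
          pair.\<close>
        have "t > 1" using True q1 by linarith
        then have "X > of_int (\<Delta> - \<delta>)" unfolding t_def using \<Delta>' by (simp add: field_simps)
        note S' = S'[OF this]
        have "min (?B 2) (?B \<lceil>t\<rceil>) \<le> ?B (q + 1)"
          by (rule affine_ge_min_endpoints) (use q1 True in auto)
        then have "- ?B (q + 1) \<le> \<bar>?B 2\<bar> \<or> - ?B (q + 1) \<le> \<bar>?B \<lceil>t\<rceil>\<bar>" by linarith
        then have "real_of_int (- ?B (q + 1)) \<le> of_int \<bar>?B 2\<bar> \<or>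
            real_of_int (- ?B (q + 1)) \<le> of_int \<bar>?B \<lceil>t\<rceil>\<bar>"
          by (simp only: of_int_le_iff)
        moreover have "\<bar>?e\<bar> \<le> of_int (- ?B (q + 1))" using neg e_ge by linarith
        ultimately have "\<bar>?e\<bar> \<le> of_int \<bar>?B 2\<bar> \<or> \<bar>?e\<bar> \<le> of_int \<bar>?B \<lceil>t\<rceil>\<bar>"
          by (meson order_trans)
        with S' err show ?thesis by auto
      next
        \<comment> \<open>Here \<open>t = q\<close> is an integer, which forces \<open>\<bar>y\<bar> = X\<close> and a zero remainder.\<close>
        case False
        then have "t \<le> of_int q" by linarith
        then have "X + of_int \<delta> \<le> of_int q * of_int \<Delta>"
          unfolding t_def using \<Delta>' by (simp add: field_simps)
        with lo yX have "\<bar>y\<bar> + of_int \<delta> = of_int q * of_int \<Delta>" by linarith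
        then have "?e = of_int (?A q)" by (simp add: algebra_simps)
        moreover have "q = \<lfloor>t\<rfloor>" using False qt by linarith
        ultimately have "\<bar>?e\<bar> = of_int \<bar>?A \<lfloor>t\<rfloor>\<bar>" by simp
        with S err show ?thesis by auto
      qed
    qed
  qed
qed

text \<open>The slope \<open>\<Gamma> - \<Delta>\<close> vanishes, so no element depends on the
  level or on \<open>X\<close> any more; \<open>X\<close> only decides which elements occur.\<close>

lemma err_set_eq_steps:
  "err_set \<delta> \<gamma> \<Delta> \<Delta> X \<subseteq> of_int ` {\<bar>\<gamma> + \<delta>\<bar>, \<bar>\<gamma> + \<delta> - \<Delta>\<bar>, \<bar>\<Delta> - \<delta>\<bar>}"
  by (auto simp: err_set_def)

lemma hadamard_abs_entry: "hadamard H \<Longrightarrow> \<bar>H $ i $ j\<bar> = 1"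
  unfolding hadamard_def by (metis abs_minus_cancel abs_one insertE singletonD)

text \<open>Row orthogonality yields \<open>H ** transpose H\<close>. A one-sided inverse of a
  square matrix is two-sided, which gives the product in the other order.\<close>

lemma hadamard_transpose_mult:
  fixes H :: "real^'n^'n"
  assumes "hadamard H"
  shows "transpose H ** H = mat (real CARD('n))"
proof -
  let ?n = "real CARD('n)"
  have "H $ i $ k * H $ i $ k = 1" for i k
    using hadamard_abs_entry[OF assms, of i k] by (metis abs_mult_self_eq mult_1)
  then have "H ** transpose H = mat ?n"
    using assms by (auto simp: vec_eq_iff matrix_matrix_mult_def transpose_def mat_def
        hadamard_def inner_vec_def row_def)
  then have "H ** ((1 / ?n) *\<^sub>R transpose H) = (1 / ?n) *\<^sub>R mat ?n"
    by (simp only: matrix_scalar_ac flip: scalar_matrix_assoc)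
  also have "\<dots> = mat 1" by (simp add: vec_eq_iff mat_def)
  finally have "H ** ((1 / ?n) *\<^sub>R transpose H) = mat 1" .
  then have "((1 / ?n) *\<^sub>R transpose H) ** H = mat 1"
    by (simp add: matrix_left_right_inverse)
  then have "(1 / ?n) *\<^sub>R (transpose H ** H) = mat 1"
    by (simp add: scalar_matrix_assoc)
  then have "?n *\<^sub>R ((1 / ?n) *\<^sub>R (transpose H ** H)) = ?n *\<^sub>R mat 1" by simp
  then show ?thesis by (simp add: vec_eq_iff mat_def)
qed

lemma infnorm_le_cart:
  fixes v :: "real^'n"
  assumes "\<And>i. \<bar>v $ i\<bar> \<le> b"
  shows "infnorm v \<le> b"
  unfolding infnorm_cart by (rule cSup_least) (use assms in auto)

text \<open>Applied to \<open>H\<close>, the factor \<open>CARD('n)\<close> cancels the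
  normalization of \<open>y\<close>; applied to \<open>transpose H\<close>, it is the factor in the
  final bound.\<close>

lemma abs_matrix_vector_mult_le:
  fixes A :: "real^'n^'m" and v :: "real^'n"
  assumes "\<And>i j. \<bar>A $ i $ j\<bar> \<le> 1" and "\<And>j. \<bar>v $ j\<bar> \<le> b"
  shows "\<bar>(A *v v) $ i\<bar> \<le> real CARD('n) * b"
proof -
  have "\<bar>A $ i $ j * v $ j\<bar> \<le> b" for j
    using mult_mono[OF assms(1)[of i j] assms(2)[of j]] by (simp add: abs_mult)
  then have "(\<Sum>j\<in>UNIV. \<bar>A $ i $ j * v $ j\<bar>) \<le> real CARD('n) * b"
    by (intro sum_bounded_above)
  then show ?thesis
    unfolding matrix_vector_mult_def vec_lambda_beta
    by (rule order_trans[OF sum_abs])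
qed

text \<open>Reduces both claims of the theorem to scalar bounds \<open>b i\<close>: the error is
  \<open>transpose H\<close> applied to coordinatewise quantization errors, each at an argument of
  size at most the norm of \<open>x\<close>.\<close>

lemma reconstruct_error_le:
  fixes H :: "real^'n^'n" and x :: "int^'n"
  assumes H: "hadamard H"
    and b: "\<And>i y. \<bar>y\<bar> \<le> infnorm (real_vec x) \<Longrightarrow> \<bar>IQ (\<gamma> i) (\<Gamma> i) (DQ (\<delta> i) (\<Delta> i) y) - y\<bar> \<le> b i"
  shows "infnorm (reconstruct H \<delta> \<gamma> \<Delta> \<Gamma> x - real_vec x) \<le> real CARD('n) * (MAX i. b i)"
proof -
  define y where "y = (1 / real CARD('n)) *\<^sub>R (H *v real_vec x)"
  define e where "e = IQ_vec \<gamma> \<Gamma> (DQ_vec \<delta> \<Delta> y) - y"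
  have "transpose H *v y = (1 / real CARD('n)) *\<^sub>R ((transpose H ** H) *v real_vec x)"
    unfolding y_def by (simp add: matrix_vector_mult_scaleR matrix_vector_mul_assoc)
  also have "\<dots> = real_vec x"
    unfolding hadamard_transpose_mult[OF H]
    by (simp add: vec_eq_iff matrix_vector_mult_def mat_def if_distrib[of "\<lambda>z. z * _"] cong: if_cong)
  finally have err: "reconstruct H \<delta> \<gamma> \<Delta> \<Gamma> x - real_vec x = transpose H *v e"
    by (simp add: reconstruct_def y_def e_def matrix_vector_mult_diff_distrib)
  have "\<bar>(H *v real_vec x) $ i\<bar> \<le> real CARD('n) * infnorm (real_vec x)" for i
    by (rule abs_matrix_vector_mult_le) (simp_all add: hadamard_abs_entry[OF H] component_le_infnorm_cart)
  then have y: "\<bar>y $ i\<bar> \<le> infnorm (real_vec x)" for i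
    unfolding y_def by (simp add: abs_mult field_simps)
  have e: "\<bar>e $ i\<bar> \<le> (MAX i. b i)" for i
  proof -
    have "\<bar>e $ i\<bar> \<le> b i" using b[OF y] by (simp add: e_def IQ_vec_def DQ_vec_def)
    also have "\<dots> \<le> (MAX i. b i)" by (rule Max_ge) auto
    finally show ?thesis .
  qed
  show ?thesis unfolding err
    by (intro infnorm_le_cart abs_matrix_vector_mult_le e)
      (simp add: transpose_def hadamard_abs_entry[OF H])
qed

theorem theorem1:
  fixes H :: "real^'n^'n"
    and \<delta> \<gamma> \<Delta> \<Gamma> :: "'n \<Rightarrow> int"
  assumes "hadamard H"
    and "\<And>i. \<Delta> i > 0"
    and "\<And>i. \<Gamma> i > 0"
  shows "(\<forall>x :: int^'n.
            infnorm (reconstruct H \<delta> \<gamma> \<Delta> \<Gamma> x - real_vec x)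
              \<le> real CARD('n) *
                 (MAX i. Max (err_set (\<delta> i) (\<gamma> i) (\<Delta> i) (\<Gamma> i) (infnorm (real_vec x))))) \<and>
         ((\<forall>i. \<Delta> i = \<Gamma> i) \<longrightarrow>
           (\<forall>x :: int^'n.
              infnorm (reconstruct H \<delta> \<gamma> \<Delta> \<Gamma> x - real_vec x)
                \<le> real CARD('n) *
                   (MAX i. of_int (Max {\<bar>\<gamma> i + \<delta> i\<bar>, \<bar>\<gamma> i + \<delta> i - \<Delta> i\<bar>, \<bar>\<Delta> i - \<delta> i\<bar>}))))"
proof (intro conjI allI impI)
  fix x :: "int^'n"
  let ?X = "infnorm (real_vec x)"
  show "infnorm (reconstruct H \<delta> \<gamma> \<Delta> \<Gamma> x - real_vec x)
      \<le> real CARD('n) * (MAX i. Max (err_set (\<delta> i) (\<gamma> i) (\<Delta> i) (\<Gamma> i) ?X))"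
  proof (rule reconstruct_error_le[OF assms(1)])
    fix i and y :: real
    assume "\<bar>y\<bar> \<le> ?X"
    from quantization_error_le_err_set[OF assms(2) this]
    obtain s where "s \<in> err_set (\<delta> i) (\<gamma> i) (\<Delta> i) (\<Gamma> i) ?X"
      "\<bar>IQ (\<gamma> i) (\<Gamma> i) (DQ (\<delta> i) (\<Delta> i) y) - y\<bar> \<le> s" by blast
    then show "\<bar>IQ (\<gamma> i) (\<Gamma> i) (DQ (\<delta> i) (\<Delta> i) y) - y\<bar>
        \<le> Max (err_set (\<delta> i) (\<gamma> i) (\<Delta> i) (\<Gamma> i) ?X)"
      by (elim order_trans, intro Max_ge) (auto simp: err_set_def)
  qed
next
  fix x :: "int^'n"
  assume eq: "\<forall>i. \<Delta> i = \<Gamma> i"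
  let ?T = "\<lambda>i. {\<bar>\<gamma> i + \<delta> i\<bar>, \<bar>\<gamma> i + \<delta> i - \<Delta> i\<bar>, \<bar>\<Delta> i - \<delta> i\<bar>}"
  show "infnorm (reconstruct H \<delta> \<gamma> \<Delta> \<Gamma> x - real_vec x)
      \<le> real CARD('n) * (MAX i. of_int (Max (?T i)))"
  proof (rule reconstruct_error_le[OF assms(1)])
    fix i and y :: real
    assume "\<bar>y\<bar> \<le> infnorm (real_vec x)"
    \<comment> \<open>The scalar lemma is taken with \<open>\<Delta> i\<close> in place of
      \<open>\<Gamma> i\<close>, the form that \<open>err_set_eq_steps\<close> needs;
      \<open>eq\<close> converts back at the end.\<close>
    from quantization_error_le_err_set[OF assms(2) this]
    obtain s where s: "s \<in> err_set (\<delta> i) (\<gamma> i) (\<Delta> i) (\<Delta> i) (infnorm (real_vec x))"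
      and le: "\<bar>IQ (\<gamma> i) (\<Delta> i) (DQ (\<delta> i) (\<Delta> i) y) - y\<bar> \<le> s" by blast
    from s obtain m where m: "s = of_int m" "m \<in> ?T i"
      using err_set_eq_steps by blast
    then have "m \<le> Max (?T i)" by (intro Max_ge) auto
    then show "\<bar>IQ (\<gamma> i) (\<Gamma> i) (DQ (\<delta> i) (\<Delta> i) y) - y\<bar> \<le> of_int (Max (?T i))"
      using le m(1) eq by (metis of_int_le_iff order_trans)
  qed
qed

end
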